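(* Let $\lambda\neq0$ be a real number. The Lie algebra of Killing vector fields of $(H_3,g_2)$ contains timelike vector fields and vector fields with changing causal character, but it contains neither spacelike nor null vector fields.
   Context: The Heisenberg group $H_3$ is $\mathbb{R}^3$ with global coordinates $(x,y,z)$ and multiplication $(x,y,z)(\tilde x,\tilde y,\tilde z)=(x+\tilde x,y+\tilde y,z+\tilde z-x\tilde y)$. For $\lambda\neq0$, $g_2$ is the left-invariant Lorentzian metric $g_2=\frac{1}{\lambda^2}dx^2+dy^2-(x\,dy+dz)^2$. A smooth vector field $X$ is Killing for $g$ if $\mathcal{L}_Xg=0$. A vector field $X$ is spacelike (resp. timelike) if $g(X,X)>0$ (resp. $g(X,X)<0$) at every point, and null if at every point $X\neq0$ and $g(X,X)=0$; it has changing causal character if its causal character (the sign of $g(X,X)$) depends on the point. *)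

theory Defs
  imports "HOL-Analysis.Analysis"
begin

text \<open>In finite dimension, \<open>f\<close> is \<open>C\<^sup>k\<^sup>+\<^sup>1\<close> iff it is differentiable and all its directional
  derivatives (in constant directions) are \<open>C\<^sup>k\<close>.\<close>

fun Ck :: "nat \<Rightarrow> ('a::euclidean_space \<Rightarrow> 'b::real_normed_vector) \<Rightarrow> bool" where
  "Ck 0 f \<longleftrightarrow> continuous_on UNIV f"
| "Ck (Suc k) f \<longleftrightarrow>
     (\<forall>p. f differentiable at p) \<and> (\<forall>v. Ck k (\<lambda>p. frechet_derivative f (at p) v))"

definition smooth :: "('a::euclidean_space \<Rightarrow> 'b::real_normed_vector) \<Rightarrow> bool" where
  "smooth f \<longleftrightarrow> (\<forall>k. Ck k f)"

text \<open>The manifold \<open>\<real>\<^sup>3\<close> carries global coordinates, so every tangent space is identified with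
  \<open>real ^ 3\<close> through the coordinate frame. A metric assigns to a point \<open>p\<close> a bilinear
  form \<open>g p\<close> on tangent vectors.\<close>

type_synonym point = "real ^ 3"
type_synonym vfield = "real ^ 3 \<Rightarrow> real ^ 3"
type_synonym metric = "real ^ 3 \<Rightarrow> real ^ 3 \<Rightarrow> real ^ 3 \<Rightarrow> real"

definition dir_deriv :: "vfield \<Rightarrow> (point \<Rightarrow> 'b::real_normed_vector) \<Rightarrow> point \<Rightarrow> 'b" where
  "dir_deriv X f p = frechet_derivative f (at p) (X p)"

definition lie_bracket :: "vfield \<Rightarrow> vfield \<Rightarrow> vfield" where
  "lie_bracket X Y p = dir_deriv X Y p - dir_deriv Y X p"

text \<open>\<open>(L\<^sub>X g)(Y, Z) = X(g(Y, Z)) - g([X, Y], Z) - g(Y, [X, Z])\<close>\<close>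

definition lie_derivative :: "vfield \<Rightarrow> metric \<Rightarrow> vfield \<Rightarrow> vfield \<Rightarrow> point \<Rightarrow> real" where
  "lie_derivative X g Y Z p =
     dir_deriv X (\<lambda>q. g q (Y q) (Z q)) p
     - g p (lie_bracket X Y p) (Z p) - g p (Y p) (lie_bracket X Z p)"

text \<open>The underlying set of the Lie algebra of Killing vector fields; its bracket
  is \<^const>\<open>lie_bracket\<close>.\<close>

definition killing_fields :: "metric \<Rightarrow> vfield set" where
  "killing_fields g =
     {X. smooth X \<and> (\<forall>Y Z. smooth Y \<longrightarrow> smooth Z \<longrightarrow> (\<forall>p. lie_derivative X g Y Z p = 0))}"

definition spacelike_field :: "metric \<Rightarrow> vfield \<Rightarrow> bool" where
  "spacelike_field g X \<longleftrightarrow> (\<forall>p. g p (X p) (X p) > 0)"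

definition timelike_field :: "metric \<Rightarrow> vfield \<Rightarrow> bool" where
  "timelike_field g X \<longleftrightarrow> (\<forall>p. g p (X p) (X p) < 0)"

definition null_field :: "metric \<Rightarrow> vfield \<Rightarrow> bool" where
  "null_field g X \<longleftrightarrow> (\<forall>p. X p \<noteq> 0 \<and> g p (X p) (X p) = 0)"

definition changing_causal_character :: "metric \<Rightarrow> vfield \<Rightarrow> bool" where
  "changing_causal_character g X \<longleftrightarrow>
     (\<exists>p q. sgn (g p (X p) (X p)) \<noteq> sgn (g q (X q) (X q)))"

definition heis_mult :: "point \<Rightarrow> point \<Rightarrow> point" where
  "heis_mult p q = vector [p$1 + q$1, p$2 + q$2, p$3 + q$3 - p$1 * q$2]"

text \<open>\<open>g\<^sub>2 = dx\<^sup>2/\<lambda>\<^sup>2 + dy\<^sup>2 - (x dy + dz)\<^sup>2\<close> in polarized form.\<close>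

definition g2 :: "real \<Rightarrow> metric" where
  "g2 l p u v =
     1 / l\<^sup>2 * (u$1 * v$1) + u$2 * v$2 - (p$1 * u$2 + u$3) * (p$1 * v$2 + v$3)"

lemma has_derivative_heis_mult:
  "(heis_mult a has_derivative (\<lambda>u. vector [u$1, u$2, u$3 - a$1 * u$2])) (at p)"
proof (subst has_derivative_componentwise_within, rule ballI)
  fix b :: "real ^ 3" assume "b \<in> Basis"
  then consider "b = axis 1 1" | "b = axis 2 1" | "b = axis 3 1"
    by (auto simp: Basis_vec_def) (metis exhaust_3)
  then show "((\<lambda>q. heis_mult a q \<bullet> b) has_derivative
      (\<lambda>u. vector [u$1, u$2, u$3 - a$1 * u$2] \<bullet> b)) (at p)"
    by cases (auto simp: inner_axis heis_mult_def vector_3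
        intro!: derivative_eq_intros bounded_linear.has_derivative[OF bounded_linear_vec_nth])
qed

lemma g2_left_invariant:
  "g2 l (heis_mult a p) (frechet_derivative (heis_mult a) (at p) u)
     (frechet_derivative (heis_mult a) (at p) v) = g2 l p u v"
  unfolding frechet_derivative_at[OF has_derivative_heis_mult, symmetric]
  by (simp add: g2_def heis_mult_def vector_3 algebra_simps)

text \<open>A pseudo-orthonormal frame of signature \<open>(+, +, -)\<close>.\<close>

lemma g2_lorentzian:
  fixes l :: real and p :: point
  defines "e1 \<equiv> vector [l, 0, 0]" and "e2 \<equiv> vector [0, 1, - p$1]" and "e3 \<equiv> vector [0, 0, 1]"
  assumes "l \<noteq> 0"
  shows "g2 l p e1 e1 = 1" "g2 l p e2 e2 = 1" "g2 l p e3 e3 = -1"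
    "g2 l p e1 e2 = 0" "g2 l p e1 e3 = 0" "g2 l p e2 e3 = 0"
  using assms by (simp_all add: g2_def vector_3 power2_eq_square)

end

theory Submission
  imports Defs
begin

text \<open>
  For \<open>X = P \<partial>\<^sub>x + Q \<partial>\<^sub>y + S \<partial>\<^sub>z\<close> put \<open>R = x Q + S = - g\<^sub>2(X, \<partial>\<^sub>z)\<close>. Differentiating the Killing
  equations and interchanging partial derivatives forces \<open>P\<close>, \<open>Q\<close>, \<open>R\<close> to be independent of \<open>z\<close>.
  The remaining equations integrate to
  \<open>P = a - \<lambda>\<^sup>2 d y\<close>, \<open>Q = b + d x\<close>, \<open>R = c + b x - a y + d (x\<^sup>2 + \<lambda>\<^sup>2 y\<^sup>2) / 2\<close>.
  If \<open>g\<^sub>2(X, X) = P\<^sup>2 / \<lambda>\<^sup>2 + Q\<^sup>2 - R\<^sup>2\<close> is nowhere negative, comparing growth along the coordinate axes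
  successively gives \<open>d = b = a = c = 0\<close>; so \<open>X\<close> vanishes at the origin and is neither spacelike nor null.
  The fields \<open>\<partial>\<^sub>z\<close> and \<open>\<partial>\<^sub>y\<close> are Killing, with squared lengths \<open>-1\<close> and \<open>1 - x\<^sup>2\<close>.
\<close>

section \<open>Directional derivatives and the calculus of smooth functions\<close>

text \<open>The direction is the first argument, so that \<open>dd v f\<close> is again a function
  of the point and second derivatives are \<open>dd w (dd v f)\<close>.\<close>

definition dd :: "'a::euclidean_space \<Rightarrow> ('a \<Rightarrow> 'b::real_normed_vector) \<Rightarrow> 'a \<Rightarrow> 'b" where
  "dd v f p = frechet_derivative f (at p) v"

lemma dd_eqI: "(f has_derivative f') (at p) \<Longrightarrow> dd v f p = f' v"
  by (simp add: dd_def frechet_derivative_at[symmetric])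

lemma dd_of_zero: "(\<And>q. f q = 0) \<Longrightarrow> dd v f p = 0"
  by (metis (no_types) dd_eqI has_derivative_const ext)

lemma has_derivative_dd:
  "f differentiable at p \<Longrightarrow> (f has_derivative (\<lambda>v. dd v f p)) (at p)"
  unfolding dd_def by (simp add: frechet_derivative_works[symmetric] eta_contract_eq)

lemma Ck_const: "Ck k (\<lambda>p. c)"
proof (induction k arbitrary: c)
  case (Suc k)
  then show ?case by simp
qed simp

text \<open>The recursion for \<open>Ck\<close> asserts continuity only at its last stage.
  Differentiability supplies it at the base, and induction carries it upwards.\<close>

lemma Ck_Suc_imp_Ck: "Ck (Suc k) f \<Longrightarrow> Ck k f"
proof (induction k arbitrary: f)
  case 0
  then show ?case
    by (auto intro!: differentiable_imp_continuous_on simp: differentiable_on_def)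
qed (metis Ck.simps(2))

lemma Ck_Suc_iff: "Ck (Suc k) f \<longleftrightarrow> (\<forall>p. f differentiable at p) \<and> (\<forall>v. Ck k (dd v f))"
  by (simp add: dd_def[abs_def])

declare Ck.simps(2) [simp del]

lemma Ck_bounded_linear_comp:
  assumes "bounded_linear L"
  shows "Ck k f \<Longrightarrow> Ck k (\<lambda>p. L (f p))"
proof (induction k arbitrary: f)
  case 0
  then show ?case
    using assms by (auto intro: bounded_linear.continuous_on)
next
  case (Suc k)
  have der: "((\<lambda>p. L (f p)) has_derivative (\<lambda>v. L (dd v f p))) (at p)" for p
    using Suc.prems by (intro bounded_linear.has_derivative[OF assms] has_derivative_dd)
      (simp add: Ck_Suc_iff)
  have "dd v (\<lambda>p. L (f p)) = (\<lambda>p. L (dd v f p))" for v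
    using dd_eqI[OF der] by auto
  with der Suc show ?case
    by (auto simp: Ck_Suc_iff differentiable_def)
qed

lemma Ck_bounded_linear:
  assumes "bounded_linear L"
  shows "Ck k L"
proof (cases k)
  case 0
  then show ?thesis
    using assms by (simp add: linear_continuous_on)
next
  case (Suc n)
  have der: "(L has_derivative L) (at p)" for p
    by (rule bounded_linear_imp_has_derivative[OF assms])
  have "dd v L = (\<lambda>p. L v)" for v
    using dd_eqI[OF der] by auto
  with der Suc show ?thesis
    by (auto simp: Ck_Suc_iff differentiable_def Ck_const)
qed

lemma Ck_add: "Ck k f \<Longrightarrow> Ck k g \<Longrightarrow> Ck k (\<lambda>p. f p + g p)"
proof (induction k arbitrary: f g)
  case 0
  then show ?case by (simp add: continuous_on_add)
next
  case (Suc k)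
  have der: "((\<lambda>p. f p + g p) has_derivative (\<lambda>v. dd v f p + dd v g p)) (at p)" for p
    using Suc.prems by (intro has_derivative_add has_derivative_dd) (simp_all add: Ck_Suc_iff)
  have "dd v (\<lambda>p. f p + g p) = (\<lambda>p. dd v f p + dd v g p)" for v
    using dd_eqI[OF der] by auto
  with der Suc show ?case
    by (auto simp: Ck_Suc_iff differentiable_def)
qed

lemma Ck_mult:
  fixes f g :: "'a::euclidean_space \<Rightarrow> 'b::real_normed_algebra"
  shows "Ck k f \<Longrightarrow> Ck k g \<Longrightarrow> Ck k (\<lambda>p. f p * g p)"
proof (induction k arbitrary: f g)
  case 0
  then show ?case by (simp add: continuous_on_mult)
next
  case (Suc k)
  have der: "((\<lambda>p. f p * g p) has_derivative (\<lambda>v. f p * dd v g p + dd v f p * g p)) (at p)" for p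
    using Suc.prems by (intro has_derivative_mult has_derivative_dd) (simp_all add: Ck_Suc_iff)
  have "dd v (\<lambda>p. f p * g p) = (\<lambda>p. f p * dd v g p + dd v f p * g p)" for v
    using dd_eqI[OF der] by auto
  \<comment> \<open>The product rule leaves one factor undifferentiated in each summand, so the
    induction hypothesis also needs \<open>f\<close> and \<open>g\<close> themselves to be
    \<open>Ck k\<close>.\<close>
  moreover have "Ck k (\<lambda>p. f p * dd v g p + dd v f p * g p)" for v
    using Suc.prems Suc.prems[THEN Ck_Suc_imp_Ck] by (intro Ck_add Suc.IH) (simp_all add: Ck_Suc_iff)
  ultimately show ?case
    using der by (auto simp: Ck_Suc_iff differentiable_def)
qed

lemma smooth_const: "smooth (\<lambda>p. c)"
  by (simp add: smooth_def Ck_const)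

lemma smooth_differentiable: "smooth f \<Longrightarrow> f differentiable at p"
  by (metis smooth_def Ck_Suc_iff)

lemma smooth_continuous: "smooth f \<Longrightarrow> continuous_on UNIV f"
  by (metis smooth_def Ck.simps(1))

lemma smooth_dd: "smooth f \<Longrightarrow> smooth (dd v f)"
  by (metis smooth_def Ck_Suc_iff)

lemma smooth_add: "smooth f \<Longrightarrow> smooth g \<Longrightarrow> smooth (\<lambda>p. f p + g p)"
  by (simp add: smooth_def Ck_add)

lemma smooth_mult:
  fixes f g :: "'a::euclidean_space \<Rightarrow> 'b::real_normed_algebra"
  shows "smooth f \<Longrightarrow> smooth g \<Longrightarrow> smooth (\<lambda>p. f p * g p)"
  by (simp add: smooth_def Ck_mult)

lemma smooth_bounded_linear_comp:
  "bounded_linear L \<Longrightarrow> smooth f \<Longrightarrow> smooth (\<lambda>p. L (f p))"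
  by (simp add: smooth_def Ck_bounded_linear_comp)

lemma smooth_bounded_linear: "bounded_linear L \<Longrightarrow> smooth L"
  by (simp add: smooth_def Ck_bounded_linear)

section \<open>Symmetry of second derivatives\<close>

text \<open>The chain rule restricts \<open>f\<close> to a line, where the one-variable mean value
  theorem applies.\<close>

lemma has_real_derivative_along_line:
  fixes f :: "'a::euclidean_space \<Rightarrow> real"
  assumes "smooth f"
  shows "((\<lambda>t. f (p + t *\<^sub>R v)) has_real_derivative dd v f (p + t *\<^sub>R v)) (at t)"
proof -
  have f: "(f has_derivative (\<lambda>u. dd u f (p + t *\<^sub>R v))) (at (p + t *\<^sub>R v))"
    by (rule has_derivative_dd[OF smooth_differentiable[OF assms]])
  then have lin: "linear (\<lambda>u. dd u f (p + t *\<^sub>R v))"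
    by (rule has_derivative_linear)
  have "((\<lambda>t. p + t *\<^sub>R v) has_derivative (\<lambda>s. s *\<^sub>R v)) (at t)"
    by (auto intro!: derivative_eq_intros)
  from has_derivative_compose[OF this f] linear_scale[OF lin] show ?thesis
    by (simp add: has_field_derivative_def mult_commute_abs)
qed

text \<open>The difference on the left is symmetric in \<open>v\<close> and \<open>w\<close>, which yields the symmetry of second
  derivatives as \<open>h\<close> tends to \<open>0\<close>.\<close>

lemma second_difference_eq_dd_dd:
  fixes f :: "'a::euclidean_space \<Rightarrow> real"
  assumes f: "smooth f" and h: "h > 0"
  shows "\<exists>a. norm (a - p) \<le> h * (norm v + norm w) \<and>
    f (p + h *\<^sub>R v + h *\<^sub>R w) - f (p + h *\<^sub>R v) - f (p + h *\<^sub>R w) + f p = h\<^sup>2 * dd w (dd v f) a"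
proof -
  \<comment> \<open>\<open>\<phi>\<close> is the increment of \<open>f\<close> in direction
    \<open>w\<close>, followed along \<open>v\<close>. The mean value theorem in \<open>s\<close>,
    and then once more along \<open>w\<close>, turns the second difference into a second derivative
    at an intermediate point.\<close>
  define \<phi> where "\<phi> = (\<lambda>s. f ((p + h *\<^sub>R w) + s *\<^sub>R v) - f (p + s *\<^sub>R v))"
  have \<phi>: "(\<phi> has_real_derivative
      dd v f ((p + h *\<^sub>R w) + s *\<^sub>R v) - dd v f (p + s *\<^sub>R v)) (at s)" for s
    unfolding \<phi>_def by (intro DERIV_diff has_real_derivative_along_line f)
  obtain s where s: "0 < s" "s < h"
    "\<phi> h - \<phi> 0 = h * (dd v f ((p + h *\<^sub>R w) + s *\<^sub>R v) - dd v f (p + s *\<^sub>R v))"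
    using MVT2[OF h \<phi>] by auto
  have "((\<lambda>t. dd v f ((p + s *\<^sub>R v) + t *\<^sub>R w)) has_real_derivative
      dd w (dd v f) ((p + s *\<^sub>R v) + t *\<^sub>R w)) (at t)" for t
    by (intro has_real_derivative_along_line smooth_dd f)
  with MVT2[OF h, of "\<lambda>t. dd v f ((p + s *\<^sub>R v) + t *\<^sub>R w)"
      "\<lambda>t. dd w (dd v f) ((p + s *\<^sub>R v) + t *\<^sub>R w)"] obtain t where t: "0 < t" "t < h"
    "dd v f ((p + s *\<^sub>R v) + h *\<^sub>R w) - dd v f ((p + s *\<^sub>R v) + 0 *\<^sub>R w)
      = (h - 0) * dd w (dd v f) ((p + s *\<^sub>R v) + t *\<^sub>R w)"
    by blast
  define a where "a = p + s *\<^sub>R v + t *\<^sub>R w"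
  have "\<phi> h - \<phi> 0 = h\<^sup>2 * dd w (dd v f) a"
    using s(3) t(3) by (simp add: a_def power2_eq_square algebra_simps)
  moreover have "norm (a - p) \<le> h * (norm v + norm w)"
  proof -
    have "norm (a - p) \<le> s * norm v + t * norm w"
      using norm_triangle_ineq[of "s *\<^sub>R v" "t *\<^sub>R w"] s t by (simp add: a_def add.assoc)
    also have "\<dots> \<le> h * norm v + h * norm w"
      using s t by (intro add_mono mult_right_mono) auto
    finally show ?thesis by (simp add: distrib_left)
  qed
  ultimately show ?thesis
    by (intro exI[of _ a]) (simp add: \<phi>_def algebra_simps)
qed

lemma dd_commute:
  fixes f :: "'a::euclidean_space \<Rightarrow> real"
  assumes "smooth f"
  shows "dd v (dd w f) = dd w (dd v f)"
proof
  fix p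
  \<comment> \<open>With step \<open>1 / Suc n\<close> the intermediate points tend to
    \<open>p\<close>, so continuity of the second derivative gives the limit.\<close>
  have approx: "\<exists>a. (\<forall>n. f (p + (1 / Suc n) *\<^sub>R v + (1 / Suc n) *\<^sub>R w) - f (p + (1 / Suc n) *\<^sub>R v)
       - f (p + (1 / Suc n) *\<^sub>R w) + f p = (1 / Suc n)\<^sup>2 * dd w (dd v f) (a n)) \<and>
      (\<lambda>n. dd w (dd v f) (a n)) \<longlonglongrightarrow> dd w (dd v f) p" for v w
  proof -
    have "\<forall>n. \<exists>a. norm (a - p) \<le> (1 / Suc n) * (norm v + norm w) \<and>
      f (p + (1 / Suc n) *\<^sub>R v + (1 / Suc n) *\<^sub>R w) - f (p + (1 / Suc n) *\<^sub>R v)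
       - f (p + (1 / Suc n) *\<^sub>R w) + f p = (1 / Suc n)\<^sup>2 * dd w (dd v f) a"
      by (intro allI second_difference_eq_dd_dd assms) simp
    then obtain a where a: "\<And>n. norm (a n - p) \<le> (1 / Suc n) * (norm v + norm w)"
      "\<And>n. f (p + (1 / Suc n) *\<^sub>R v + (1 / Suc n) *\<^sub>R w) - f (p + (1 / Suc n) *\<^sub>R v)
       - f (p + (1 / Suc n) *\<^sub>R w) + f p = (1 / Suc n)\<^sup>2 * dd w (dd v f) (a n)"
      by metis
    have "(\<lambda>n. (1 / Suc n) * (norm v + norm w)) \<longlonglongrightarrow> 0"
      using LIMSEQ_inverse_real_of_nat by (intro tendsto_mult_left_zero) (simp add: inverse_eq_divide)
    then have "(\<lambda>n. norm (a n - p)) \<longlonglongrightarrow> 0"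
      by (rule tendsto_sandwich[rotated 3]) (use a(1) in auto)
    then have "a \<longlonglongrightarrow> p"
      using LIM_zero_cancel tendsto_norm_zero_iff by blast
    moreover have "isCont (dd w (dd v f)) p"
      using smooth_continuous[OF smooth_dd[OF smooth_dd[OF assms]]]
      by (simp add: continuous_on_eq_continuous_at)
    ultimately show ?thesis
      using a(2) by (blast intro: isCont_tendsto_compose)
  qed
  from approx[of v w] obtain a where a: "\<And>n. f (p + (1 / Suc n) *\<^sub>R v + (1 / Suc n) *\<^sub>R w)
      - f (p + (1 / Suc n) *\<^sub>R v) - f (p + (1 / Suc n) *\<^sub>R w) + f p
      = (1 / Suc n)\<^sup>2 * dd w (dd v f) (a n)" "(\<lambda>n. dd w (dd v f) (a n)) \<longlonglongrightarrow> dd w (dd v f) p"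
    by blast
  from approx[of w v] obtain b where b: "\<And>n. f (p + (1 / Suc n) *\<^sub>R w + (1 / Suc n) *\<^sub>R v)
      - f (p + (1 / Suc n) *\<^sub>R w) - f (p + (1 / Suc n) *\<^sub>R v) + f p
      = (1 / Suc n)\<^sup>2 * dd v (dd w f) (b n)" "(\<lambda>n. dd v (dd w f) (b n)) \<longlonglongrightarrow> dd v (dd w f) p"
    by blast
  \<comment> \<open>Both sides come from the same second difference; the positive factor
    \<open>(1 / Suc n)\<^sup>2\<close> cancels.\<close>
  have "dd w (dd v f) (a n) = dd v (dd w f) (b n)" for n
  proof -
    have "(1 / real (Suc n))\<^sup>2 * dd w (dd v f) (a n) = (1 / real (Suc n))\<^sup>2 * dd v (dd w f) (b n)"
      unfolding a(1)[symmetric] b(1)[symmetric] by (simp add: algebra_simps)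
    then show ?thesis by simp
  qed
  with a(2) b(2) show "dd v (dd w f) p = dd w (dd v f) p"
    by (simp add: LIMSEQ_unique)
qed

section \<open>Partial derivatives on three-space and integration of gradients\<close>

abbreviation pd :: "3 \<Rightarrow> (point \<Rightarrow> real) \<Rightarrow> point \<Rightarrow> real" where
  "pd i \<equiv> dd (axis i 1)"

text \<open>Linearity of the derivative, applied to the expansion of \<open>h\<close> in the
  standard basis. This turns equations for partial derivatives into a total derivative that can be
  integrated.\<close>

lemma has_derivative_pd:
  fixes f :: "point \<Rightarrow> real"
  assumes "smooth f"
  shows "(f has_derivative (\<lambda>h. h$1 * pd 1 f p + h$2 * pd 2 f p + h$3 * pd 3 f p)) (at p)"
proof -
  have f: "(f has_derivative (\<lambda>h. dd h f p)) (at p)"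
    by (rule has_derivative_dd[OF smooth_differentiable[OF assms]])
  have "dd h f p = h$1 * pd 1 f p + h$2 * pd 2 f p + h$3 * pd 3 f p" for h
  proof -
    have "h = h$1 *\<^sub>R axis 1 1 + h$2 *\<^sub>R axis 2 1 + h$3 *\<^sub>R axis 3 1"
      by (simp add: vec_eq_iff forall_3 axis_def)
    then have "dd h f p = dd (h$1 *\<^sub>R axis 1 1 + h$2 *\<^sub>R axis 2 1 + h$3 *\<^sub>R axis 3 1) f p"
      by (rule arg_cong)
    also have "\<dots> = h$1 * pd 1 f p + h$2 * pd 2 f p + h$3 * pd 3 f p"
      using linear_add[OF has_derivative_linear[OF f]] linear_scale[OF has_derivative_linear[OF f]]
      by simp
    finally show ?thesis .
  qed
  then show ?thesis
    by (intro has_derivative_eq_rhs[OF f] ext)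
qed

text \<open>The difference has derivative zero on the whole space, which is convex. Each use below
  produces one integration constant.\<close>

lemma eq_plus_const_if_same_derivative:
  fixes f F :: "point \<Rightarrow> real"
  assumes "\<And>p. (f has_derivative f' p) (at p)" "\<And>p. (F has_derivative f' p) (at p)"
  obtains c where "\<And>p. f p = F p + c"
proof -
  have "((\<lambda>p. f p - F p) has_derivative (\<lambda>h. 0)) (at p within UNIV)" for p
    using has_derivative_diff[OF assms[of p]] by simp
  then obtain c where "\<And>p. f p - F p = c"
    using has_derivative_zero_constant[OF convex_UNIV, of "\<lambda>p. f p - F p"] by auto
  then show ?thesis by (intro that[of c]) (simp add: algebra_simps)
qed

lemma dd_nth:
  "X differentiable at p \<Longrightarrow> dd v (\<lambda>q. X q $ i) p = dd v X p $ i"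
  by (rule dd_eqI[OF bounded_linear.has_derivative[OF bounded_linear_vec_nth has_derivative_dd]])

lemma smooth_nth: "smooth X \<Longrightarrow> smooth (\<lambda>q. X q $ i)"
  by (rule smooth_bounded_linear_comp[OF bounded_linear_vec_nth])

lemma smooth_coord: "smooth (\<lambda>q. q $ i)"
  by (rule smooth_bounded_linear[OF bounded_linear_vec_nth])

lemma has_derivative_divide_const:
  fixes f :: "'a::real_normed_vector \<Rightarrow> real"
  shows "(f has_derivative f') F \<Longrightarrow> ((\<lambda>x. f x / c) has_derivative (\<lambda>h. f' h / c)) F"
  using bounded_linear.has_derivative[OF bounded_linear_divide] .

lemma has_derivative_nth: "((\<lambda>q. q $ i) has_derivative (\<lambda>h. h $ i)) (at p within S)"
  by (rule bounded_linear_imp_has_derivative[OF bounded_linear_vec_nth])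

section \<open>The Lie derivative of \<open>g2\<close>\<close>

text \<open>The coefficients of \<open>g2\<close> depend on x only, so only the first component of
  \<open>X\<close> enters.\<close>

lemma dir_deriv_g2_const:
  "dir_deriv X (\<lambda>q. g2 l q u v) p
    = - X p $ 1 * (u$2 * (p$1 * v$2 + v$3) + (p$1 * u$2 + u$3) * v$2)"
  unfolding dir_deriv_def dd_def[symmetric]
  by (rule dd_eqI[where f' = "\<lambda>h. - h $ 1 * (u$2 * (p$1 * v$2 + v$3) + (p$1 * u$2 + u$3) * v$2)", THEN trans])
    (auto simp: g2_def algebra_simps intro!: derivative_eq_intros has_derivative_nth)

lemma dir_deriv_g2:
  assumes Y: "smooth Y" and Z: "smooth Z"
  shows "dir_deriv X (\<lambda>q. g2 l q (Y q) (Z q)) p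
    = g2 l p (dd (X p) Y p) (Z p) + g2 l p (Y p) (dd (X p) Z p)
      + dir_deriv X (\<lambda>q. g2 l q (Y p) (Z p)) p"
proof -
  have Y': "((\<lambda>q. Y q $ i) has_derivative (\<lambda>h. dd h Y p $ i)) (at p)" for i
    by (rule bounded_linear.has_derivative[OF bounded_linear_vec_nth
          has_derivative_dd[OF smooth_differentiable[OF Y]]])
  have Z': "((\<lambda>q. Z q $ i) has_derivative (\<lambda>h. dd h Z p $ i)) (at p)" for i
    by (rule bounded_linear.has_derivative[OF bounded_linear_vec_nth
          has_derivative_dd[OF smooth_differentiable[OF Z]]])
  define k where "k = 1 / l\<^sup>2"
  show ?thesis
    unfolding dir_deriv_g2_const unfolding dir_deriv_def dd_def[symmetric] g2_def k_def[symmetric]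
    \<comment> \<open>The candidate derivative is the sum of the three terms of the claim, written
      in components with \<open>h\<close> in place of \<open>X p\<close>.\<close>
    by (rule dd_eqI[where f' = "\<lambda>h. k * (dd h Y p$1 * Z p$1) + dd h Y p$2 * Z p$2
           - (p$1 * dd h Y p$2 + dd h Y p$3) * (p$1 * Z p$2 + Z p$3)
         + (k * (Y p$1 * dd h Z p$1) + Y p$2 * dd h Z p$2
           - (p$1 * Y p$2 + Y p$3) * (p$1 * dd h Z p$2 + dd h Z p$3))
         + - h $ 1 * (Y p$2 * (p$1 * Z p$2 + Z p$3) + (p$1 * Y p$2 + Y p$3) * Z p$2)", THEN trans])
     (auto simp: algebra_simps fun_eq_iff intro!: derivative_eq_intros has_derivative_nth Y' Z')
qed

lemma g2_diff_left: "g2 l p (u - u') v = g2 l p u v - g2 l p u' v"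
  and g2_diff_right: "g2 l p u (v - v') = g2 l p u v - g2 l p u v'"
  by (simp_all add: g2_def algebra_simps)

text \<open>The derivatives of \<open>Y\<close> and \<open>Z\<close> along \<open>X\<close> cancel
  against those in the brackets. What remains depends on \<open>Y\<close> and \<open>Z\<close> only
  through their values at \<open>p\<close>, so the Killing condition can be tested on constant
  fields.\<close>

lemma lie_derivative_g2:
  assumes "smooth Y" "smooth Z"
  shows "lie_derivative X (g2 l) Y Z p = dir_deriv X (\<lambda>q. g2 l q (Y p) (Z p)) p
    + g2 l p (dd (Y p) X p) (Z p) + g2 l p (Y p) (dd (Z p) X p)"
  unfolding lie_derivative_def dir_deriv_g2[OF assms]
  by (simp add: lie_bracket_def dir_deriv_def dd_def g2_diff_left g2_diff_right)

text \<open>Such fields generate translations in the y and z directions, and these preserve the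
  coefficients of \<open>g2\<close>.\<close>

lemma const_in_killing_fields:
  assumes "c $ 1 = 0"
  shows "(\<lambda>p. c) \<in> killing_fields (g2 l)"
  using assms by (auto simp: killing_fields_def smooth_const lie_derivative_g2 dir_deriv_g2_const)
    (simp_all add: dd_def g2_def)

section \<open>The Killing equations and their integration\<close>

lemma killing_field_g2_constant_arguments:
  assumes "X \<in> killing_fields (g2 l)"
  shows "dir_deriv X (\<lambda>q. g2 l q u v) p + g2 l p (dd u X p) v + g2 l p u (dd v X p) = 0"
  using assms lie_derivative_g2[of "\<lambda>p. u" "\<lambda>p. v" X l p] by (simp add: killing_fields_def smooth_const)

text \<open>One equation arises for each unordered pair of coordinate vectors. In terms of
  \<open>r\<close>, the three pairs involving the z direction give the gradient of
  \<open>r\<close>.\<close>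

lemma killing_equations_g2:
  fixes X l
  defines "r \<equiv> \<lambda>q. X q $ 3 + q $ 1 * X q $ 2"
  assumes l: "l \<noteq> 0" and X: "X \<in> killing_fields (g2 l)"
  shows "pd 1 (\<lambda>q. X q $ 1) p = 0"
    and "pd 2 (\<lambda>q. X q $ 2) p = p $ 1 * pd 3 (\<lambda>q. X q $ 2) p"
    and "l\<^sup>2 * pd 1 (\<lambda>q. X q $ 2) p = p $ 1 * pd 3 (\<lambda>q. X q $ 1) p - pd 2 (\<lambda>q. X q $ 1) p"
    and "pd 1 r p = X p $ 2 + pd 3 (\<lambda>q. X q $ 1) p / l\<^sup>2"
    and "pd 2 r p = pd 3 (\<lambda>q. X q $ 2) p - X p $ 1"
    and "pd 3 r p = 0"
proof -
  have smooth: "smooth X" using X by (simp add: killing_fields_def)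
  note diff = smooth_differentiable[OF smooth]
  have r: "(r has_derivative (\<lambda>h. dd h X p $ 3 + (p $ 1 * dd h X p $ 2 + h $ 1 * X p $ 2))) (at p)"
    unfolding r_def
    by (intro has_derivative_add has_derivative_mult has_derivative_nth
        bounded_linear.has_derivative[OF bounded_linear_vec_nth has_derivative_dd[OF diff]])
  note ev = killing_field_g2_constant_arguments[OF X, of _ _ p, unfolded dir_deriv_g2_const, unfolded g2_def]
  note s = dd_nth[OF diff] dd_eqI[OF r] axis_def
  have k11: "dd (axis 1 1) X p $ 1 = 0"
    using ev[of "axis 1 1" "axis 1 1"] l by (simp add: axis_def)
  \<comment> \<open>The order matters: \<open>k33\<close> simplifies \<open>k23\<close>, which
    simplifies \<open>k22\<close>, and \<open>k13\<close> simplifies \<open>k12\<close>.\<close>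
  have k33: "dd (axis 3 1) X p $ 3 = - p$1 * dd (axis 3 1) X p $ 2"
    using ev[of "axis 3 1" "axis 3 1"] by (simp add: axis_def)
  have k13: "dd (axis 1 1) X p $ 3 + p$1 * dd (axis 1 1) X p $ 2 = dd (axis 3 1) X p $ 1 / l\<^sup>2"
    using ev[of "axis 1 1" "axis 3 1"] by (simp add: axis_def)
  have k23: "dd (axis 2 1) X p $ 3 = dd (axis 3 1) X p $ 2 - X p $ 1 - p$1 * dd (axis 2 1) X p $ 2"
    using ev[of "axis 2 1" "axis 3 1"] k33 by (simp add: axis_def)
  have k22: "dd (axis 2 1) X p $ 2 = p$1 * dd (axis 3 1) X p $ 2"
    using ev[of "axis 2 1" "axis 2 1", unfolded k23] by (simp add: axis_def algebra_simps)
  have k12: "dd (axis 1 1) X p $ 2 + dd (axis 2 1) X p $ 1 / l\<^sup>2 = p$1 * (dd (axis 3 1) X p $ 1 / l\<^sup>2)"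
    using ev[of "axis 1 1" "axis 2 1"] unfolding k13[symmetric] by (simp add: axis_def algebra_simps)
  show "pd 1 (\<lambda>q. X q $ 1) p = 0" using k11 by (simp add: s)
  show "pd 2 (\<lambda>q. X q $ 2) p = p $ 1 * pd 3 (\<lambda>q. X q $ 2) p" using k22 by (simp add: s)
  show "l\<^sup>2 * pd 1 (\<lambda>q. X q $ 2) p = p $ 1 * pd 3 (\<lambda>q. X q $ 1) p - pd 2 (\<lambda>q. X q $ 1) p"
    using k12 l by (simp add: s field_simps)
  show "pd 1 r p = X p $ 2 + pd 3 (\<lambda>q. X q $ 1) p / l\<^sup>2" using k13 by (simp add: s)
  show "pd 2 r p = pd 3 (\<lambda>q. X q $ 2) p - X p $ 1" using k23 by (simp add: s)
  show "pd 3 r p = 0" using k33 by (simp add: s)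
qed

text \<open>The constants \<open>a\<close>, \<open>b\<close>, \<open>c\<close> are the components of
  \<open>X\<close> at the origin, and \<open>d\<close> is the coefficient of an infinitesimal
  rotation fixing the origin. In particular the Killing fields form a space of dimension at most
  four.\<close>

lemma killing_fields_g2_explicit:
  assumes l: "l \<noteq> 0" and X: "X \<in> killing_fields (g2 l)"
  obtains a b c d where
    "\<And>p. X p $ 1 = a - l\<^sup>2 * d * p$2"
    "\<And>p. X p $ 2 = b + d * p$1"
    "\<And>p. X p $ 3 + p$1 * X p $ 2
       = c + b * p$1 + d * (p$1)\<^sup>2 / 2 - a * p$2 + l\<^sup>2 * d * (p$2)\<^sup>2 / 2"
proof -
  define P Q R where "P = (\<lambda>q. X q $ 1)" and "Q = (\<lambda>q. X q $ 2)"
    and "R = (\<lambda>q. X q $ 3 + q $ 1 * X q $ 2)"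
  have "smooth X" using X by (simp add: killing_fields_def)
  then have smooth: "smooth P" "smooth Q" "smooth R"
    unfolding P_def Q_def R_def by (intro smooth_nth smooth_add smooth_mult smooth_coord; assumption)+
  have smooth_pd: "smooth (pd i P)" "smooth (pd i Q)" for i
    by (intro smooth_dd smooth)+
  have P1: "pd 1 P p = 0"
    and Q2: "pd 2 Q p = p $ 1 * pd 3 Q p"
    and Q1: "l\<^sup>2 * pd 1 Q p = p $ 1 * pd 3 P p - pd 2 P p"
    and R1: "pd 1 R p = Q p + pd 3 P p / l\<^sup>2"
    and R2: "pd 2 R p = pd 3 Q p - P p"
    and R3: "pd 3 R p = 0" for p
    using killing_equations_g2[OF l X, of p] unfolding P_def Q_def R_def by blast+
  have dP: "((\<lambda>p. pd i P p) has_derivative (\<lambda>v. dd v (pd i P) p)) (at p)"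
    and dQ: "((\<lambda>p. pd i Q p) has_derivative (\<lambda>v. dd v (pd i Q) p)) (at p)"
    and dP0: "(P has_derivative (\<lambda>v. dd v P p)) (at p)"
    and dQ0: "(Q has_derivative (\<lambda>v. dd v Q p)) (at p)" for i p
    by (intro has_derivative_dd smooth_differentiable smooth smooth_pd)+
  have P31: "pd 1 (pd 3 P) p = 0" for p
    using dd_commute[OF smooth(1), of "axis 1 1" "axis 3 1"] dd_of_zero[of "pd 1 P", OF P1] by simp
  \<comment> \<open>Here and in \<open>Q33\<close>, the z-derivative of a component of the gradient
    of \<open>R\<close> vanishes, because it may be interchanged with \<open>R3\<close>.\<close>
  have P33: "pd 3 (pd 3 P) p = - l\<^sup>2 * pd 3 Q p" for p
  proof -
    have "(pd 1 R has_derivative (\<lambda>v. dd v Q p + dd v (pd 3 P) p / l\<^sup>2)) (at p)"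
      unfolding R1[abs_def] by (intro has_derivative_add has_derivative_divide_const dP dQ0)
    from dd_eqI[OF this] have "pd 3 (pd 1 R) p = pd 3 Q p + pd 3 (pd 3 P) p / l\<^sup>2" .
    moreover have "pd 3 (pd 1 R) p = 0"
      using dd_commute[OF smooth(3), of "axis 3 1" "axis 1 1"] dd_of_zero[of "pd 3 R", OF R3] by simp
    ultimately show ?thesis using l by (simp add: field_simps)
  qed
  have Q33: "pd 3 (pd 3 Q) p = pd 3 P p" for p
  proof -
    have "(pd 2 R has_derivative (\<lambda>v. dd v (pd 3 Q) p - dd v P p)) (at p)"
      unfolding R2[abs_def] by (auto intro!: derivative_eq_intros dQ dP0)
    from dd_eqI[OF this] have "pd 3 (pd 2 R) p = pd 3 (pd 3 Q) p - pd 3 P p" .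
    moreover have "pd 3 (pd 2 R) p = 0"
      using dd_commute[OF smooth(3), of "axis 3 1" "axis 2 1"] dd_of_zero[of "pd 3 R", OF R3] by simp
    ultimately show ?thesis by simp
  qed
  \<comment> \<open>By \<open>P33\<close>, \<open>pd 3 Q\<close> is a multiple of
    \<open>pd 3 (pd 3 P)\<close>, which inherits independence of x from \<open>P\<close>.\<close>
  have Q31: "pd 1 (pd 3 Q) p = 0" for p
  proof -
    have Q3: "pd 3 Q = (\<lambda>p. (- 1 / l\<^sup>2) * pd 3 (pd 3 P) p)"
      using P33 l by auto
    have "(pd 3 Q has_derivative (\<lambda>v. (- 1 / l\<^sup>2) * dd v (pd 3 (pd 3 P)) p)) (at p)"
      unfolding Q3 by (intro has_derivative_mult_right has_derivative_dd smooth_differentiable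
          smooth_dd smooth)
    moreover have "pd 1 (pd 3 (pd 3 P)) p = 0"
      using dd_commute[OF smooth_pd(1)[of 3], of "axis 1 1" "axis 3 1"]
        dd_of_zero[of "pd 1 (pd 3 P)", OF P31] by simp
    ultimately show ?thesis by (simp add: dd_eqI)
  qed
  have Q32: "pd 2 (pd 3 Q) p = p $ 1 * pd 3 P p" for p
  proof -
    have "(pd 2 Q has_derivative (\<lambda>v. p $ 1 * dd v (pd 3 Q) p + v $ 1 * pd 3 Q p)) (at p)"
      unfolding Q2[abs_def] by (intro has_derivative_mult has_derivative_nth dQ)
    from dd_eqI[OF this, of "axis 3 1", unfolded Q33] have "pd 3 (pd 2 Q) p = p $ 1 * pd 3 P p"
      by (simp add: axis_def)
    then show ?thesis
      using dd_commute[OF smooth(2), of "axis 2 1" "axis 3 1"] by simp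
  qed
  \<comment> \<open>\<open>pd 3 Q\<close> does not depend on x, so neither does its y-derivative. By
    \<open>Q32\<close> that derivative is x times \<open>pd 3 P\<close>, and \<open>pd 3 P\<close>
    is itself independent of x, hence zero.\<close>
  have P3: "pd 3 P p = 0" for p
  proof -
    have "(pd 2 (pd 3 Q) has_derivative (\<lambda>v. p $ 1 * dd v (pd 3 P) p + v $ 1 * pd 3 P p)) (at p)"
      unfolding Q32[abs_def] by (intro has_derivative_mult has_derivative_nth dP)
    from dd_eqI[OF this, of "axis 1 1", unfolded P31] have "pd 1 (pd 2 (pd 3 Q)) p = pd 3 P p"
      by (simp add: axis_def)
    moreover have "pd 1 (pd 2 (pd 3 Q)) p = 0"
      using dd_commute[OF smooth_pd(2)[of 3], of "axis 1 1" "axis 2 1"]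
        dd_of_zero[of "pd 1 (pd 3 Q)", OF Q31] by simp
    ultimately show ?thesis by simp
  qed
  have Q3: "pd 3 Q p = 0" for p
    using P33[of p] dd_of_zero[of "pd 3 P", OF P3] l by simp
  have Q2': "pd 2 Q p = 0" and P2: "pd 2 P p = - l\<^sup>2 * pd 1 Q p" for p
    using Q2[of p] Q1[of p] Q3 P3 by simp_all
  \<comment> \<open>All three partial derivatives of \<open>pd 1 Q\<close> are shown to vanish; its
    constant value is \<open>d\<close>.\<close>
  have "pd 1 (pd 1 Q) p = 0" for p
  proof -
    have "(pd 2 P has_derivative (\<lambda>v. - l\<^sup>2 * dd v (pd 1 Q) p)) (at p)"
      unfolding P2[abs_def] by (intro has_derivative_mult_right dQ)
    from dd_eqI[OF this] have "pd 1 (pd 2 P) p = - l\<^sup>2 * pd 1 (pd 1 Q) p" .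
    moreover have "pd 1 (pd 2 P) p = 0"
      using dd_commute[OF smooth(1), of "axis 1 1" "axis 2 1"] dd_of_zero[of "pd 1 P", OF P1] by simp
    ultimately show ?thesis using l by simp
  qed
  moreover have "pd 2 (pd 1 Q) p = 0" "pd 3 (pd 1 Q) p = 0" for p
    using dd_commute[OF smooth(2), of "axis 2 1" "axis 1 1"] dd_of_zero[of "pd 2 Q", OF Q2']
      dd_commute[OF smooth(2), of "axis 3 1" "axis 1 1"] dd_of_zero[of "pd 3 Q", OF Q3] by simp_all
  ultimately have "(pd 1 Q has_derivative (\<lambda>h. 0)) (at p)" for p
    using has_derivative_pd[OF smooth_pd(2), of 1 p] by simp
  from eq_plus_const_if_same_derivative[OF this has_derivative_const[of 0]]
  obtain d where d: "\<And>p. pd 1 Q p = d" by auto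
  have "(Q has_derivative (\<lambda>h. d * h$1)) (at p)" for p
    using has_derivative_pd[OF smooth(2), of p] by (simp add: d Q2' Q3 mult.commute)
  from eq_plus_const_if_same_derivative[OF this has_derivative_mult_right[OF has_derivative_nth]]
  obtain b where b: "\<And>p. Q p = d * p$1 + b" by blast
  have "(P has_derivative (\<lambda>h. - l\<^sup>2 * d * h$2)) (at p)" for p
    using has_derivative_pd[OF smooth(1), of p] by (simp add: d P1 P2 P3 mult_ac)
  from eq_plus_const_if_same_derivative[OF this has_derivative_mult_right[OF has_derivative_nth]]
  obtain a where a: "\<And>p. P p = - l\<^sup>2 * d * p$2 + a" by blast
  have R: "(R has_derivative (\<lambda>h. h$1 * (d * p$1 + b) + h$2 * (l\<^sup>2 * d * p$2 - a))) (at p)" for p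
    using has_derivative_pd[OF smooth(3), of p] by (simp add: R1 R2 R3 P3 Q3 a b)
  \<comment> \<open>This polynomial is an explicit potential for the gradient (Q, -P, 0) of
    \<open>R\<close>.\<close>
  have "((\<lambda>p. b * p$1 + d * (p$1)\<^sup>2 / 2 - a * p$2 + l\<^sup>2 * d * (p$2)\<^sup>2 / 2)
      has_derivative (\<lambda>h. h$1 * (d * p$1 + b) + h$2 * (l\<^sup>2 * d * p$2 - a))) (at p)" for p :: point
    by (auto intro!: derivative_eq_intros has_derivative_nth simp: algebra_simps)
  from eq_plus_const_if_same_derivative[OF R this]
  obtain c where "\<And>p. R p = b * p$1 + d * (p$1)\<^sup>2 / 2 - a * p$2 + l\<^sup>2 * d * (p$2)\<^sup>2 / 2 + c" by blast
  with a b show ?thesis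
    by (intro that[of a d b c]) (simp_all add: P_def Q_def R_def)
qed

section \<open>Causal character of the Killing fields\<close>

text \<open>A polynomial with positive leading coefficient is eventually at least as large as that
  coefficient.\<close>

lemma lead_coeff_nonpos_if_poly_nonpos:
  fixes f :: "real poly"
  assumes "\<And>x. poly f x \<le> 0"
  shows "lead_coeff f \<le> 0"
proof (rule ccontr)
  assume "\<not> lead_coeff f \<le> 0"
  moreover from this obtain n where "\<And>x. x \<ge> n \<Longrightarrow> poly f x \<ge> lead_coeff f"
    using poly_pinfty_gt_lc[of f] by auto
  ultimately show False
    using assms[of n] by fastforce
qed

text \<open>Nonnegativity covers the spacelike and the null case at once, and vanishing at the
  origin contradicts both.\<close>

lemma nonneg_killing_field_g2_zero_at_origin:
  assumes l: "l \<noteq> 0" and X: "X \<in> killing_fields (g2 l)"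
    and nonneg: "\<And>p. g2 l p (X p) (X p) \<ge> 0"
  shows "X 0 = 0"
proof -
  obtain a b c d where e: "\<And>p. X p $ 1 = a - l\<^sup>2 * d * p$2" "\<And>p. X p $ 2 = b + d * p$1"
    "\<And>p. X p $ 3 + p$1 * X p $ 2
       = c + b * p$1 + d * (p$1)\<^sup>2 / 2 - a * p$2 + l\<^sup>2 * d * (p$2)\<^sup>2 / 2"
    by (rule killing_fields_g2_explicit[OF l X]) (rule that)
  \<comment> \<open>The squared length does not depend on z, so points with z = 0 carry all the
    information.\<close>
  have ineq: "(c + b * x + d * x\<^sup>2 / 2 - a * y + l\<^sup>2 * d * y\<^sup>2 / 2)\<^sup>2
      \<le> (a - l\<^sup>2 * d * y)\<^sup>2 / l\<^sup>2 + (b + d * x)\<^sup>2" for x y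
    using nonneg[of "vector [x, y, 0]"] e[of "vector [x, y, 0]"]
    by (simp add: g2_def add.commute power2_eq_square)
  have d: "d = 0"
  proof (rule ccontr)
    assume "d \<noteq> 0"
    \<comment> \<open>This is the negative of the squared length on the x axis, a quartic with
      leading coefficient \<open>d\<^sup>2 / 4\<close>. Once \<open>d = 0\<close>, its leading
      coefficient becomes \<open>b\<^sup>2\<close>, and the y axis then yields
      \<open>a\<^sup>2\<close>.\<close>
    have "poly [: c\<^sup>2 - b\<^sup>2 - a\<^sup>2 / l\<^sup>2, 2 * b * c - 2 * b * d, b\<^sup>2 + c * d - d\<^sup>2, b * d, d\<^sup>2 / 4 :] x \<le> 0" for x
      using ineq[of x 0] by (simp add: power2_eq_square algebra_simps)
    from lead_coeff_nonpos_if_poly_nonpos[OF this] \<open>d \<noteq> 0\<close> show False by simp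
  qed
  have b: "b = 0"
  proof (rule ccontr)
    assume "b \<noteq> 0"
    have "poly [: c\<^sup>2 - b\<^sup>2 - a\<^sup>2 / l\<^sup>2, 2 * b * c, b\<^sup>2 :] x \<le> 0" for x
      using ineq[of x 0] d by (simp add: power2_eq_square algebra_simps)
    from lead_coeff_nonpos_if_poly_nonpos[OF this] \<open>b \<noteq> 0\<close> show False by simp
  qed
  have a: "a = 0"
  proof (rule ccontr)
    assume "a \<noteq> 0"
    have "poly [: c\<^sup>2 - a\<^sup>2 / l\<^sup>2, - 2 * a * c, a\<^sup>2 :] x \<le> 0" for x
      using ineq[of 0 x] d b by (simp add: power2_eq_square algebra_simps)
    from lead_coeff_nonpos_if_poly_nonpos[OF this] \<open>a \<noteq> 0\<close> show False by simp
  qed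
  have "c = 0" using ineq[of 0 0] a b d by simp
  then show ?thesis using e[of 0] a b d by (simp add: vec_eq_iff forall_3)
qed

theorem proposition3p6:
  fixes l :: real
  assumes "l \<noteq> 0"
  shows "(\<exists>X\<in>killing_fields (g2 l). timelike_field (g2 l) X)
       \<and> (\<exists>X\<in>killing_fields (g2 l). changing_causal_character (g2 l) X)
       \<and> \<not> (\<exists>X\<in>killing_fields (g2 l). spacelike_field (g2 l) X)
       \<and> \<not> (\<exists>X\<in>killing_fields (g2 l). null_field (g2 l) X)"
proof (intro conjI notI)
  show "\<exists>X\<in>killing_fields (g2 l). timelike_field (g2 l) X"
    by (intro bexI[of _ "\<lambda>p. axis 3 1"] const_in_killing_fields)
      (simp_all add: timelike_field_def g2_def axis_def)
next
  \<comment> \<open>The two points are the origin and (2, 0, 0), where the squared length of the y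
    coordinate field is 1 and -3.\<close>
  have "sgn (g2 l 0 (axis 2 1) (axis 2 1)) \<noteq> sgn (g2 l (axis 1 2) (axis 2 1) (axis 2 1))"
    by (simp add: g2_def axis_def)
  then show "\<exists>X\<in>killing_fields (g2 l). changing_causal_character (g2 l) X"
    by (intro bexI[of _ "\<lambda>p. axis 2 1"] const_in_killing_fields)
      (auto simp: changing_causal_character_def axis_def)
next
  assume "\<exists>X\<in>killing_fields (g2 l). spacelike_field (g2 l) X"
  then obtain X where X: "X \<in> killing_fields (g2 l)" "\<And>p. g2 l p (X p) (X p) > 0"
    by (auto simp: spacelike_field_def)
  then have "X 0 = 0"
    by (intro nonneg_killing_field_g2_zero_at_origin[OF assms]) (auto intro: less_imp_le)
  with X(2)[of 0] show False by (simp add: g2_def)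
next
  assume "\<exists>X\<in>killing_fields (g2 l). null_field (g2 l) X"
  then obtain X where X: "X \<in> killing_fields (g2 l)"
    "\<And>p. X p \<noteq> 0" "\<And>p. g2 l p (X p) (X p) = 0"
    by (auto simp: null_field_def)
  with nonneg_killing_field_g2_zero_at_origin[OF assms X(1)] show False by simp
qed

end
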